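(* Let $\mathbb{F}_q$ be a finite field. Then there exist linearly independent (over $\mathbb{F}_q$) homogeneous polynomials $F_0, F_1, F_2, F_3 \in \mathbb{F}_q[x,y,z]$ of degree $3$ such that the linear system $\mathcal{L} = \langle F_0, F_1, F_2, F_3\rangle \cong \mathbb{P}^3$ of plane cubic curves satisfies both of the following: (i) every $\mathbb{F}_q$-member of $\mathcal{L}$ is irreducible over $\mathbb{F}_q$; and (ii) at most one $\mathbb{F}_q$-member of $\mathcal{L}$ is geometrically reducible.
   Context: The $\mathbb{F}_q$-members of $\mathcal{L} = \langle F_0, F_1, F_2, F_3\rangle$ are the plane curves $\{a_0F_0 + a_1F_1 + a_2F_2 + a_3F_3 = 0\} \subset \mathbb{P}^2$ indexed by the points $[a_0:a_1:a_2:a_3] \in \mathbb{P}^3(\mathbb{F}_q)$ (so nonzero coefficient vectors in $\mathbb{F}_q^4$ up to scaling by $\mathbb{F}_q^*$). A plane cubic curve $\{F=0\}$, with $F \in \mathbb{F}_q[x,y,z]$ a nonzero homogeneous polynomial of degree $3$, is irreducible over $\mathbb{F}_q$ if $F$ is irreducible in $\mathbb{F}_q[x,y,z]$; it is geometrically irreducible if $F$ is irreducible in $\overline{\mathbb{F}_q}[x,y,z]$, where $\overline{\mathbb{F}_q}$ is an algebraic closure of $\mathbb{F}_q$, and geometrically reducible otherwise. *)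

theory Defs
  imports
    "HOL-Library.Poly_Mapping"
    "HOL-Library.Numeral_Type"
    "HOL-Analysis.Finite_Cartesian_Product"
    "HOL-Algebra.Algebraic_Closure_Type"
begin

text \<open>
  Polynomials in three variables are finitely supported maps from exponent vectors to
  coefficients, with the convolution product of \<^theory>\<open>HOL-Library.Poly_Mapping\<close>. The variables
  $x, y, z$ are the three elements of the numeral type \<^typ>\<open>3\<close>.
\<close>

type_synonym 'a ternary_poly = "(3 \<Rightarrow>\<^sub>0 nat) \<Rightarrow>\<^sub>0 'a"

definition const_poly :: "'a::zero \<Rightarrow> 'a ternary_poly"
  where "const_poly c = Poly_Mapping.single 0 c"

definition homogeneous :: "nat \<Rightarrow> 'a::zero ternary_poly \<Rightarrow> bool"
  where "homogeneous d F \<longleftrightarrow>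
    (\<forall>m \<in> Poly_Mapping.keys F. (\<Sum>i\<in>UNIV. Poly_Mapping.lookup m i) = d)"

definition irreducible_poly :: "'a::field ternary_poly \<Rightarrow> bool"
  where "irreducible_poly F \<longleftrightarrow> Factorial_Ring.irreducible F"

text \<open>The coefficients are pushed into the algebraic closure \<^typ>\<open>'a alg_closure\<close> along \<^const>\<open>to_ac\<close>.\<close>

definition geometrically_irreducible :: "'a::field ternary_poly \<Rightarrow> bool"
  where "geometrically_irreducible F \<longleftrightarrow> irreducible_poly (Poly_Mapping.map to_ac F)"

definition member :: "(4 \<Rightarrow> 'a::field ternary_poly) \<Rightarrow> 'a ^ 4 \<Rightarrow> 'a ternary_poly"
  where "member F a = (\<Sum>i\<in>UNIV. const_poly (a $ i) * F i)"

definition linearly_independent :: "(4 \<Rightarrow> 'a::field ternary_poly) \<Rightarrow> bool"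
  where "linearly_independent F \<longleftrightarrow> (\<forall>a. member F a = 0 \<longrightarrow> a = 0)"

text \<open>Equality of the points of projective 3-space with homogeneous coordinates \<open>a\<close> and \<open>b\<close>.\<close>

definition same_point :: "'a::field ^ 4 \<Rightarrow> 'a ^ 4 \<Rightarrow> bool"
  where "same_point a b \<longleftrightarrow> (\<exists>c. c \<noteq> 0 \<and> b = c *s a)"

end

theory Submission
  imports Defs "HOL-Analysis.Cartesian_Space"
begin

text \<open>The system consists of the cubics over $F_q$ through a point $P$ of degree six, that is, through six
points of the plane over $F_{q^6}$ that Frobenius permutes cyclically. Cubic forms have ten
coefficients, and the six conditions leave a space of dimension four.

The point is chosen to lie on no conic over $F_q$. A member that splits over $F_q$ contains a line over
$F_q$ and a residual conic over $F_q$, and one of the two would have to contain $P$; so every member is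
irreducible over $F_q$. A member that splits over the algebraic closure contains a line, and with it
all Frobenius images of the line. A cubic contains at most three lines, so the line is defined over
$F_{q^2}$ or $F_{q^3}$. A line over $F_{q^2}$ together with its conjugate would produce a conic over $F_q$,
so the member is the union of three conjugate lines over $F_{q^3}$, one of which passes through $P$. A
line over $F_{q^3}$ through $P$ also contains the third Frobenius image of $P$, so it joins these two
points. Hence this member is unique.

For an explicit version take $P = [1 : \<alpha> : \<beta>]$ with \<open>\<alpha>\<close> cubic over $F_q$ and \<open>\<beta>\<close> quadratic over
$F_{q^3}$. The third Frobenius image of $P$ has the same first two coordinates, so the special line is
$y = \<alpha> x$. The equations of \<open>\<alpha>\<close> and \<open>\<beta>\<close> then give the four generators in closed form, and the last
of them is the special member $y^3 - x y^2 - c x^3$. By \<open>reducible_cubic_contains_line\<close> a reducible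
cubic contains a line, and \<open>contained_line\<close> shows that among the members only multiples of the last
generator contain a line over the algebraic closure. The reasons are in \<open>contained_line_period\<close> (few
Frobenius images), \<open>contained_line_avoids_point\<close> (a line not through $[0 : 0 : 1]$ cannot pass through
any of the six points) and \<open>contains_no_nonvertical_line\<close> (it cannot avoid all six points either).\<close>

section \<open>Homomorphisms out of a monoid algebra\<close>

text \<open>The universal property of a monoid algebra: a map of coefficients and a multiplicative character
of the exponents together determine a homomorphism. Evaluation at a point, with the coefficients
mapped to a larger field, and the decomposition into homogeneous components are both of this form.\<close>

definition monoid_alg_lift :: "('a::zero \<Rightarrow> 'b::comm_ring_1) \<Rightarrow> ('k \<Rightarrow> 'b) \<Rightarrow> ('k \<Rightarrow>\<^sub>0 'a) \<Rightarrow> 'b"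
  where "monoid_alg_lift \<phi> \<theta> F = (\<Sum>m\<in>Poly_Mapping.keys F. \<phi> (Poly_Mapping.lookup F m) * \<theta> m)"

locale coeff_hom =
  fixes \<phi> :: "'a::comm_ring_1 \<Rightarrow> 'b::comm_ring_1"
  assumes hom_0 [simp]: "\<phi> 0 = 0"
    and hom_1 [simp]: "\<phi> 1 = 1"
    and hom_add [simp]: "\<phi> (a + b) = \<phi> a + \<phi> b"
    and hom_mult [simp]: "\<phi> (a * b) = \<phi> a * \<phi> b"
begin

lemma lift_superset:
  assumes "finite S" "Poly_Mapping.keys F \<subseteq> S"
  shows "monoid_alg_lift \<phi> \<theta> F = (\<Sum>m\<in>S. \<phi> (Poly_Mapping.lookup F m) * \<theta> m)"
  unfolding monoid_alg_lift_def
  by (rule sum.mono_neutral_left) (use assms in \<open>auto simp: in_keys_iff\<close>)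

lemma lift_single [simp]: "monoid_alg_lift \<phi> \<theta> (Poly_Mapping.single m c) = \<phi> c * \<theta> m"
  by (subst lift_superset[of "{m}"]) auto

lemma lift_0 [simp]: "monoid_alg_lift \<phi> \<theta> 0 = 0"
  by (simp add: monoid_alg_lift_def)

lemma lift_add [simp]:
  "monoid_alg_lift \<phi> \<theta> (F + G) = monoid_alg_lift \<phi> \<theta> F + monoid_alg_lift \<phi> \<theta> G"
proof -
  let ?S = "Poly_Mapping.keys F \<union> Poly_Mapping.keys G"
  have "Poly_Mapping.keys (F + G) \<subseteq> ?S"
    by (rule keys_add)
  then show ?thesis
    by (subst (1 2 3) lift_superset[of ?S])
       (auto simp: lookup_add distrib_right sum.distrib)
qed

lemma lift_sum:
  "monoid_alg_lift \<phi> \<theta> (\<Sum>i\<in>I. F i) = (\<Sum>i\<in>I. monoid_alg_lift \<phi> \<theta> (F i))"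
  by (induction I rule: infinite_finite_induct) auto

end

lemma poly_mapping_sum_single:
  "F = (\<Sum>m\<in>Poly_Mapping.keys F. Poly_Mapping.single m (Poly_Mapping.lookup F m))"
  by (rule poly_mapping_eqI) (auto simp: lookup_sum lookup_single when_def in_keys_iff)

locale monoid_alg_hom = coeff_hom \<phi>
  for \<phi> :: "'a::comm_ring_1 \<Rightarrow> 'b::comm_ring_1" +
  fixes \<theta> :: "'k::comm_monoid_add \<Rightarrow> 'b"
  assumes char_0 [simp]: "\<theta> 0 = 1"
    and char_add: "\<theta> (m + n) = \<theta> m * \<theta> n"
begin

lemma lift_1 [simp]: "monoid_alg_lift \<phi> \<theta> 1 = 1"
  unfolding single_one[symmetric] by (subst lift_single) simp

lemma lift_mult:
  "monoid_alg_lift \<phi> \<theta> (F * G) = monoid_alg_lift \<phi> \<theta> F * monoid_alg_lift \<phi> \<theta> G"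
proof -
  let ?l = "monoid_alg_lift \<phi> \<theta>"
  have "?l (F * G) = ?l ((\<Sum>m\<in>Poly_Mapping.keys F. Poly_Mapping.single m (Poly_Mapping.lookup F m)) *
      (\<Sum>n\<in>Poly_Mapping.keys G. Poly_Mapping.single n (Poly_Mapping.lookup G n)))"
    by (simp flip: poly_mapping_sum_single)
  also have "\<dots> = ?l F * ?l G"
    unfolding sum_product
    by (simp add: lift_sum mult_single char_add monoid_alg_lift_def[of \<phi> \<theta> F] monoid_alg_lift_def[of \<phi> \<theta> G]
         sum_product algebra_simps)
  finally show ?thesis .
qed

end

text \<open>This is used as a fact rather than as an interpretation: for the identity, the simplification rules
of the locale would rewrite every sum and every product to itself.\<close>

lemma coeff_hom_id: "coeff_hom (\<lambda>c. c)"
  by unfold_locales auto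

section \<open>Homogeneous factors and linear factors\<close>

definition total_degree :: "(3 \<Rightarrow>\<^sub>0 nat) \<Rightarrow> nat"
  where "total_degree m = (\<Sum>i\<in>UNIV. Poly_Mapping.lookup m i)"

lemma total_degree_0 [simp]: "total_degree 0 = 0"
  by (simp add: total_degree_def)

lemma total_degree_add [simp]: "total_degree (m + n) = total_degree m + total_degree n"
  by (simp add: total_degree_def lookup_add sum.distrib)

lemma homogeneous_iff:
  "homogeneous d F \<longleftrightarrow> (\<forall>m. Poly_Mapping.lookup F m \<noteq> 0 \<longrightarrow> total_degree m = d)"
  by (auto simp: homogeneous_def total_degree_def in_keys_iff)

text \<open>This homomorphism sends $F = \<Sum>_k F_k$, with $F_k$ homogeneous of degree $k$, to
$\<Sum>_k F_k t^k$. It turns the total degree into the degree in one variable $t$ over an integral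
domain.\<close>

definition grading :: "'a::comm_ring_1 ternary_poly \<Rightarrow> 'a ternary_poly poly"
  where "grading = monoid_alg_lift (\<lambda>c. [:const_poly c:])
           (\<lambda>m. monom (Poly_Mapping.single m 1) (total_degree m))"

interpretation grading: monoid_alg_hom "\<lambda>c. [:const_poly c:]"
    "\<lambda>m. monom (Poly_Mapping.single m (1::'a::comm_ring_1)) (total_degree m)"
  by unfold_locales
    (auto simp: const_poly_def single_add mult_single mult_monom monom_0 one_pCons mult.commute)

lemma coeff_grading:
  fixes F :: "'a::comm_ring_1 ternary_poly"
  shows "Poly_Mapping.lookup (coeff (grading F) k) m =
    (if total_degree m = k then Poly_Mapping.lookup F m else 0)"
proof -
  have "coeff (grading F) k = (\<Sum>m\<in>Poly_Mapping.keys F.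
      if total_degree m = k then Poly_Mapping.single m (Poly_Mapping.lookup F m) else 0)"
    unfolding grading_def monoid_alg_lift_def
    by (auto simp: coeff_sum const_poly_def mult_single smult_monom intro!: sum.cong)
  then have "Poly_Mapping.lookup (coeff (grading F) k) m = (\<Sum>n\<in>Poly_Mapping.keys F.
      if n = m then (if total_degree m = k then Poly_Mapping.lookup F m else 0) else 0)"
    by (simp only: lookup_sum) (intro sum.cong; auto simp: lookup_single when_def)
  then show ?thesis
    by (auto simp: in_keys_iff)
qed

lemma grading_homogeneous:
  fixes F :: "'a::comm_ring_1 ternary_poly"
  assumes "homogeneous d F"
  shows "grading F = monom F d"
  using assms by (intro poly_eqI poly_mapping_eqI) (auto simp: coeff_grading homogeneous_iff)

text \<open>The degree and the order of vanishing at 0 are both additive, the order is at most the degree, and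
for a monomial they agree; hence they agree for each factor.\<close>

lemma factors_of_monom:
  fixes p q :: "'r::idom poly"
  assumes "p * q = monom c n" "c \<noteq> 0"
  shows "\<exists>i j a b. p = monom a i \<and> q = monom b j \<and> i + j = n"
proof -
  have nz: "p \<noteq> 0" "q \<noteq> 0" "p * q \<noteq> 0"
    using assms by auto
  have split: "\<exists>r. p = monom 1 (order 0 p) * r \<and> r \<noteq> 0" if "p \<noteq> 0" for p :: "'r poly"
  proof -
    have "monom 1 (order 0 p) dvd p"
      using that by (simp add: monom_1_dvd_iff)
    then obtain r where r: "p = monom 1 (order 0 p) * r"
      by (rule dvdE)
    moreover have "r \<noteq> 0"
      using that r by (metis mult_zero_right)
    ultimately show ?thesis by metis
  qed
  obtain r where r: "p = monom 1 (order 0 p) * r" "r \<noteq> 0"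
    using split nz by blast
  obtain s where s: "q = monom 1 (order 0 q) * s" "s \<noteq> 0"
    using split nz by blast
  have "order 0 p + order 0 q = order 0 (monom c n)"
    using nz assms by (metis order_mult)
  also have "\<dots> = n"
    using assms by (simp add: order_0_monom)
  finally have ord: "order 0 p + order 0 q = n" .
  have "degree p = order 0 p + degree r"
    by (subst r(1), subst degree_mult_eq) (use r in \<open>auto simp: degree_monom_eq\<close>)
  moreover have "degree q = order 0 q + degree s"
    by (subst s(1), subst degree_mult_eq) (use s in \<open>auto simp: degree_monom_eq\<close>)
  moreover have "degree p + degree q = n"
    using nz assms by (metis degree_monom_eq degree_mult_eq)
  ultimately have "degree r = 0" "degree s = 0"
    using ord by auto
  then obtain a b where "r = [:a:]" "s = [:b:]"
    by (metis degree_eq_zeroE)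
  then have "p = monom a (order 0 p)" "q = monom b (order 0 q)"
    using r s by (simp_all add: smult_monom mult.commute)
  then show ?thesis
    using ord by blast
qed

text \<open>The grading turns a homogeneous polynomial into a monomial in $t$, so that the images of the factors
are monomials in $t$ as well.\<close>

lemma homogeneous_factors:
  fixes G H :: "'a::idom ternary_poly"
  assumes "homogeneous d (G * H)" "G * H \<noteq> 0"
  shows "\<exists>i j. homogeneous i G \<and> homogeneous j H \<and> i + j = d"
proof -
  have "grading G * grading H = monom (G * H) d"
    using assms grading_homogeneous[of d "G * H"]
    by (simp add: grading_def grading.lift_mult)
  with factors_of_monom[OF this assms(2)] obtain i j a b
    where *: "grading G = monom a i" "grading H = monom b j" "i + j = d"
    by blast
  have "homogeneous i F" if "grading F = monom a i" for F :: "'a ternary_poly" and a i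
    unfolding homogeneous_iff
  proof (intro allI impI)
    fix m assume "Poly_Mapping.lookup F m \<noteq> 0"
    then show "total_degree m = i"
      using coeff_grading[of F "total_degree m" m] that by (auto split: if_splits)
  qed
  with * show ?thesis by blast
qed

lemma total_degree_eq_0_iff: "total_degree m = 0 \<longleftrightarrow> m = 0"
  by (auto simp: total_degree_def poly_mapping_eq_iff fun_eq_iff)

lemma total_degree_eq_1D:
  assumes "total_degree m = 1"
  shows "m \<in> {Poly_Mapping.single 1 1, Poly_Mapping.single 2 1, Poly_Mapping.single 3 1}"
proof -
  have s: "Poly_Mapping.lookup m 1 + Poly_Mapping.lookup m 2 + Poly_Mapping.lookup m 3 = 1"
    using assms by (simp add: total_degree_def sum_3)
  then obtain i where i: "Poly_Mapping.lookup m i = 1" and other: "\<forall>j. j \<noteq> i \<longrightarrow> Poly_Mapping.lookup m j = 0"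
    unfolding forall_3 by (cases "Poly_Mapping.lookup m 1"; cases "Poly_Mapping.lookup m 2"; force)
  have "m = Poly_Mapping.single i 1"
    by (rule poly_mapping_eqI) (use i other in \<open>auto simp: lookup_single when_def\<close>)
  then show ?thesis
    using exhaust_3[of i] by auto
qed

lemma homogeneous_0_is_unit:
  fixes G :: "'a::field ternary_poly"
  assumes "homogeneous 0 G" "G \<noteq> 0"
  shows "G dvd 1"
proof -
  let ?c = "Poly_Mapping.lookup G 0"
  have G: "G = Poly_Mapping.single 0 ?c"
    by (rule poly_mapping_eqI)
       (use assms in \<open>auto simp: lookup_single when_def homogeneous_iff total_degree_eq_0_iff\<close>)
  then have "?c \<noteq> 0"
    using assms by (metis single_zero)
  then have "G * Poly_Mapping.single 0 (inverse ?c) = 1"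
    by (subst G) (simp add: mult_single)
  then show ?thesis
    by (metis dvd_triv_left)
qed

text \<open>The coefficients are moved along \<open>\<phi>\<close>, so that a form over a small field can be evaluated at points
over a larger one.\<close>

definition eval_at :: "('a::comm_ring_1 \<Rightarrow> 'b::comm_ring_1) \<Rightarrow> 'b \<Rightarrow> 'b \<Rightarrow> 'b \<Rightarrow> 'a ternary_poly \<Rightarrow> 'b"
  where "eval_at \<phi> x y z = monoid_alg_lift \<phi>
    (\<lambda>m. x ^ Poly_Mapping.lookup m 1 * y ^ Poly_Mapping.lookup m 2 * z ^ Poly_Mapping.lookup m 3)"

lemma coeff_hom_eval:
  assumes "coeff_hom \<phi>"
  shows "monoid_alg_hom \<phi>
    (\<lambda>m::3 \<Rightarrow>\<^sub>0 nat. x ^ Poly_Mapping.lookup m 1 * y ^ Poly_Mapping.lookup m 2 * z ^ Poly_Mapping.lookup m 3)"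
proof -
  interpret coeff_hom \<phi> by fact
  show ?thesis
    by unfold_locales (auto simp: lookup_add power_add algebra_simps)
qed

context coeff_hom
begin

lemma eval_0 [simp]: "eval_at \<phi> x y z 0 = 0"
  by (simp add: eval_at_def)

lemma eval_1 [simp]: "eval_at \<phi> x y z 1 = 1"
  unfolding eval_at_def
  by (rule monoid_alg_hom.lift_1[OF coeff_hom_eval]) unfold_locales

lemma eval_add [simp]: "eval_at \<phi> x y z (F + G) = eval_at \<phi> x y z F + eval_at \<phi> x y z G"
  by (simp add: eval_at_def)

lemma eval_mult [simp]: "eval_at \<phi> x y z (F * G) = eval_at \<phi> x y z F * eval_at \<phi> x y z G"
  unfolding eval_at_def
  by (rule monoid_alg_hom.lift_mult[OF coeff_hom_eval]) unfold_locales

lemma eval_single [simp]: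
  "eval_at \<phi> x y z (Poly_Mapping.single m c) =
     \<phi> c * (x ^ Poly_Mapping.lookup m 1 * y ^ Poly_Mapping.lookup m 2 * z ^ Poly_Mapping.lookup m 3)"
  by (simp add: eval_at_def)

lemma eval_const_poly [simp]: "eval_at \<phi> x y z (const_poly c) = \<phi> c"
  by (simp add: const_poly_def)

end

lemma lookup_map_0:
  "f 0 = 0 \<Longrightarrow> Poly_Mapping.lookup (Poly_Mapping.map f F) m = f (Poly_Mapping.lookup F m)"
  by (simp add: Poly_Mapping.map.rep_eq when_def)

lemma eval_map:
  assumes "coeff_hom \<phi>"
  shows "eval_at (\<lambda>c. c) x y z (Poly_Mapping.map \<phi> F) = eval_at \<phi> x y z F"
proof -
  interpret coeff_hom \<phi> by fact
  have "Poly_Mapping.keys (Poly_Mapping.map \<phi> F) \<subseteq> Poly_Mapping.keys F"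
    by (auto simp: in_keys_iff lookup_map_0)
  then show ?thesis
    unfolding eval_at_def monoid_alg_lift_def[of \<phi>]
    by (subst coeff_hom.lift_superset[OF coeff_hom_id, of "Poly_Mapping.keys F"]) (auto simp: lookup_map_0)
qed

text \<open>Two nonconstant homogeneous factors of a cubic have degrees 1 and 2. The linear one vanishes on a
line, and this is all that the geometry below needs to know of a factorization. The coefficients of
the line lie in the field of \<open>F\<close>, its points in the possibly larger target of \<open>\<phi>\<close>.\<close>

lemma reducible_cubic_contains_line:
  fixes F :: "'a::field ternary_poly" and \<phi> :: "'a \<Rightarrow> 'b::field"
  assumes \<phi>: "coeff_hom \<phi>"
    and F: "homogeneous 3 F" "F \<noteq> 0" and red: "\<not> irreducible_poly F"
  shows "\<exists>u v w. \<not> (u = 0 \<and> v = 0 \<and> w = 0) \<and>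
    (\<forall>x y z. \<phi> u * x + \<phi> v * y + \<phi> w * z = 0 \<longrightarrow> eval_at \<phi> x y z F = 0)"
proof -
  have "\<not> F dvd 1"
  proof
    assume "F dvd 1"
    then obtain G where G: "1 = F * G" by (rule dvdE)
    \<comment> \<open>A cubic form vanishes at the origin, and a unit does not.\<close>
    have "0 ^ Poly_Mapping.lookup m 1 * 0 ^ Poly_Mapping.lookup m 2 * 0 ^ Poly_Mapping.lookup m 3 = (0::'a)"
      if "m \<in> Poly_Mapping.keys F" for m
    proof -
      have "Poly_Mapping.lookup m 1 + Poly_Mapping.lookup m 2 + Poly_Mapping.lookup m 3 = 3"
        using F(1) that unfolding homogeneous_def sum_3 by blast
      then have "Poly_Mapping.lookup m 1 \<noteq> 0 \<or> Poly_Mapping.lookup m 2 \<noteq> 0 \<or> Poly_Mapping.lookup m 3 \<noteq> 0"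
        by linarith
      then show ?thesis
        by (auto simp: zero_power)
    qed
    then have "eval_at (\<lambda>c. c) 0 0 0 F = 0"
      unfolding eval_at_def monoid_alg_lift_def by (intro sum.neutral) simp
    then have "eval_at (\<lambda>c. c) 0 0 0 (F * G) = 0"
      by (simp add: coeff_hom.eval_mult[OF coeff_hom_id])
    then show False
      unfolding G[symmetric] coeff_hom.eval_1[OF coeff_hom_id] by simp
  qed
  with F red obtain G H where GH: "F = G * H" "\<not> G dvd 1" "\<not> H dvd 1"
    by (auto simp: irreducible_poly_def Factorial_Ring.irreducible_def)
  have nz: "G \<noteq> 0" "H \<noteq> 0"
    using F GH by auto
  obtain i j where ij: "homogeneous i G" "homogeneous j H" "i + j = 3"
    using homogeneous_factors F GH by metis
  have "i \<noteq> 0"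
    using ij(1) GH(2) nz(1) homogeneous_0_is_unit by metis
  moreover have "j \<noteq> 0"
    using ij(2) GH(3) nz(2) homogeneous_0_is_unit by metis
  ultimately have "i = 1 \<or> j = 1"
    using ij(3) by linarith
  then obtain L M where LM: "F = L * M" "homogeneous 1 L" "L \<noteq> 0"
    using ij GH nz by (metis mult.commute)
  define l where "l = (\<lambda>i::3. Poly_Mapping.lookup L (Poly_Mapping.single i 1))"
  let ?S = "{Poly_Mapping.single 1 1, Poly_Mapping.single 2 1, Poly_Mapping.single 3 1} :: (3 \<Rightarrow>\<^sub>0 nat) set"
  have S: "Poly_Mapping.keys L \<subseteq> ?S"
    using LM(2) total_degree_eq_1D by (auto simp: homogeneous_def total_degree_def)
  interpret coeff_hom \<phi>
    by (rule \<phi>)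
  have ev: "eval_at \<phi> x y z L = \<phi> (l 1) * x + \<phi> (l 2) * y + \<phi> (l 3) * z" for x y z
  proof -
    have neq: "Poly_Mapping.single i (Suc 0) \<noteq> Poly_Mapping.single j (Suc 0)" if "i \<noteq> j" for i j :: 3
      using that by (metis lookup_single_eq lookup_single_not_eq nat.distinct(1))
    show ?thesis
      unfolding eval_at_def
      by (subst lift_superset[OF _ S]) (auto simp: neq l_def lookup_single when_def add.assoc)
  qed
  have "\<not> (l 1 = 0 \<and> l 2 = 0 \<and> l 3 = 0)"
  proof
    assume "l 1 = 0 \<and> l 2 = 0 \<and> l 3 = 0"
    moreover from LM(3) obtain m where "m \<in> Poly_Mapping.keys L"
      using keys_eq_empty by blast
    ultimately show False
      using S by (auto simp: l_def in_keys_iff)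
  qed
  moreover have "eval_at \<phi> x y z F = 0" if "\<phi> (l 1) * x + \<phi> (l 2) * y + \<phi> (l 3) * z = 0" for x y z
    using ev that by (simp add: LM(1))
  ultimately show ?thesis
    by blast
qed

section \<open>The Frobenius map on the algebraic closure\<close>

lemma poly_eq_0_if_many_roots:
  fixes p :: "'r::idom poly"
  assumes "\<And>x. x \<in> S \<Longrightarrow> poly p x = 0" "degree p < card S"
  shows "p = 0"
proof (rule ccontr)
  assume "p \<noteq> 0"
  have "card S \<le> card {x. poly p x = 0}"
    using assms(1) by (intro card_mono poly_roots_finite[OF \<open>p \<noteq> 0\<close>]) auto
  also have "\<dots> \<le> degree p"
    by (rule card_poly_roots_bound) fact
  finally show False using assms(2) by simp
qed

lemma quadratic_eq_0_if_three_roots: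
  fixes a b c :: "'r::idom"
  assumes "distinct [x, y, z]"
    "a + b * x + c * x^2 = 0" "a + b * y + c * y^2 = 0" "a + b * z + c * z^2 = 0"
  shows "a = 0 \<and> b = 0 \<and> c = 0"
proof -
  have "[:a, b, c:] = 0"
    by (rule poly_eq_0_if_many_roots[of "{x, y, z}"])
       (use assms in \<open>auto simp: power2_eq_square algebra_simps\<close>)
  then show ?thesis by simp
qed

lemma cubic_eq_0_if_four_roots:
  fixes a b c d :: "'r::idom"
  assumes "distinct [x, y, z, w]"
    "\<And>t. t \<in> {x, y, z, w} \<Longrightarrow> a + b * t + c * t^2 + d * t^3 = 0"
  shows "a = 0 \<and> b = 0 \<and> c = 0 \<and> d = 0"
proof -
  have "[:a, b, c, d:] = 0"
    by (rule poly_eq_0_if_many_roots[of "{x, y, z, w}"])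
       (use assms in \<open>auto simp: power2_eq_square power3_eq_cube algebra_simps\<close>)
  then show ?thesis by simp
qed

lemma power_card_field:
  fixes a :: "'a::field"
  assumes fin: "finite (UNIV :: 'a set)"
  shows "a ^ CARD('a) = a"
proof (cases "a = 0")
  case True
  then show ?thesis using fin by (simp add: card_gt_0_iff)
next
  case False
  let ?U = "UNIV - {0 :: 'a}"
  have "bij_betw (\<lambda>x. a * x) ?U ?U"
    by (rule bij_betwI[where g = "\<lambda>x. x / a"]) (use False in auto)
  then have "(\<Prod>x\<in>?U. x) = (\<Prod>x\<in>?U. a * x)"
    by (rule prod.reindex_bij_betw[symmetric])
  also have "\<dots> = a ^ card ?U * (\<Prod>x\<in>?U. x)"
    by (simp add: prod.distrib)
  finally have "1 * (\<Prod>x\<in>?U. x) = a ^ card ?U * (\<Prod>x\<in>?U. x)"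
    by (simp only: mult_1)
  moreover have "(\<Prod>x\<in>?U. x) \<noteq> 0"
    using fin by simp
  ultimately have "a ^ card ?U = 1"
    using mult_right_cancel by metis
  moreover have "CARD('a) = Suc (card ?U)"
    by (rule card.remove[OF fin]) simp
  ultimately show ?thesis
    by (simp only: power_Suc mult_1_right)
qed

text \<open>Over a finite field with $Q$ elements the polynomial $X^Q - X - 1$ is constantly $-1$.\<close>

lemma infinite_alg_closed_field: "infinite (UNIV :: 'k::alg_closed_field set)"
proof
  assume fin: "finite (UNIV :: 'k set)"
  let ?p = "monom 1 CARD('k) - [:1, 1:] :: 'k poly"
  have "card {0, 1 :: 'k} \<le> CARD('k)"
    by (rule card_mono[OF fin]) simp
  then have "degree ?p = CARD('k)"
    by (subst diff_conv_add_uminus, subst degree_add_eq_left) (auto simp: degree_monom_eq)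
  then obtain x where "poly ?p x = 0"
    using alg_closed_imp_poly_has_root[of ?p] fin by (auto simp: card_gt_0_iff)
  then show False
    by (simp add: poly_monom power_card_field[OF fin])
qed

definition frob :: "'a::{field, finite} alg_closure \<Rightarrow> 'a alg_closure"
  where "frob x = x ^ CARD('a)"

lemma card_field_ge_2: "2 \<le> CARD('a::{field, finite})"
  using card_mono[of "UNIV :: 'a set" "{0, 1}"] by simp

lemma frob_0 [simp]: "frob 0 = 0"
  and frob_1 [simp]: "frob 1 = 1"
  and frob_mult [simp]: "frob (x * y) = frob x * frob y"
  and frob_power [simp]: "frob (x ^ n) = frob x ^ n"
  by (simp_all add: frob_def power_mult_distrib mult.commute flip: power_mult)

lemma frob_to_ac [simp]: "frob (to_ac a) = to_ac a"
  by (simp add: frob_def power_card_field flip: to_ac_power)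

lemma card_range_to_ac: "card (range (to_ac :: 'a::{field, finite} \<Rightarrow> _)) = CARD('a)"
  by (simp add: card_image inj_to_ac)

text \<open>The polynomial $(X + 1)^q - X^q - 1$ has degree less than $q$ and vanishes at all $q$ elements of the
finite field, so it is zero. This gives additivity directly, without writing $q$ as a power of
the characteristic.\<close>

lemma frob_add_1: "frob (x + 1) = frob x + 1"
proof -
  let ?q = "CARD('a)"
  let ?g = "[:1, 1:] ^ ?q - monom 1 ?q - 1 :: 'a alg_closure poly"
  have deg: "degree ([:1, 1:] ^ ?q :: 'a alg_closure poly) = ?q"
    by (simp add: degree_power_eq)
  have "coeff ([:1, 1:] ^ ?q :: 'a alg_closure poly) ?q = 1"
    using lead_coeff_power[of "[:1, 1:] :: 'a alg_closure poly" ?q] deg by simp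
  then have "coeff ?g ?q = 0"
    using card_field_ge_2[where 'a='a] by (simp add: coeff_1)
  moreover have "degree ?g \<le> ?q"
    using deg by (intro degree_diff_le) (auto simp: degree_monom_le)
  ultimately have "?g = 0 \<or> degree ?g < ?q"
    by (metis eq_zero_or_degree_less)
  moreover have "poly ?g (to_ac a) = 0" for a
  proof -
    have "(1 + to_ac a) ^ ?q = to_ac ((1 + a) ^ ?q)"
      by simp
    also have "\<dots> = 1 + to_ac a ^ ?q"
      by (simp add: power_card_field del: to_ac_power flip: to_ac_power[of a])
    finally show ?thesis
      by (simp add: poly_monom)
  qed
  ultimately have "?g = 0"
    using poly_eq_0_if_many_roots[of "range to_ac" ?g] card_range_to_ac[where 'a='a] by auto
  then have "poly ?g x = 0"
    by simp
  then show ?thesis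
    by (simp add: poly_monom frob_def algebra_simps)
qed

lemma frob_add [simp]: "frob (x + y) = frob x + frob y"
proof (cases "y = 0")
  case False
  then have "frob (x + y) = frob (y * (x / y + 1))"
    by (simp add: algebra_simps)
  also have "\<dots> = frob (y * (x / y)) + frob y"
    by (simp only: frob_mult frob_add_1) (simp add: algebra_simps)
  finally show ?thesis
    using False by simp
qed simp

lemma frob_minus [simp]: "frob (- x) = - frob x"
  by (metis add_eq_0_iff frob_0 frob_add add.right_inverse)

lemma frob_diff [simp]: "frob (x - y) = frob x - frob y"
  using frob_add[of x "- y"] by simp

lemma frob_eq_0_iff [simp]: "frob x = 0 \<longleftrightarrow> x = 0"
  by (simp add: frob_def)

lemma frob_eq_iff [simp]: "frob x = frob y \<longleftrightarrow> x = y"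
  by (metis eq_iff_diff_eq_0 frob_diff frob_eq_0_iff)

lemma surj_frob: "\<exists>x. frob x = y"
  using nth_root_exists[of "CARD('a)" y] by (auto simp: frob_def)

lemma card_roots_power_minus_self:
  fixes S :: "'r::idom set"
  assumes "\<And>x. x \<in> S \<Longrightarrow> x ^ n = x" "2 \<le> n"
  shows "finite S \<and> card S \<le> n"
proof -
  let ?p = "monom 1 n - monom 1 1 :: 'r poly"
  have "coeff ?p n = 1"
    using assms(2) by simp
  then have nz: "?p \<noteq> 0"
    by (metis coeff_0 zero_neq_one)
  have S: "S \<subseteq> {x. poly ?p x = 0}"
    using assms(1) by (auto simp: poly_monom)
  have "card S \<le> card {x. poly ?p x = 0}"
    by (intro card_mono poly_roots_finite[OF nz] S)
  also have "\<dots> \<le> degree ?p"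
    by (rule card_poly_roots_bound[OF nz])
  also have "\<dots> \<le> n"
    using assms(2) by (intro degree_diff_le order.trans[OF degree_monom_le]) auto
  finally show ?thesis
    using finite_subset[OF S poly_roots_finite[OF nz]] by simp
qed

lemma frob_fixed:
  assumes "frob x = x"
  shows "x \<in> range to_ac"
proof (rule ccontr)
  assume "x \<notin> range to_ac"
  then have "card (insert x (range to_ac)) = Suc CARD('a)"
    using card_range_to_ac[where 'a='a] by simp
  moreover have "card (insert x (range to_ac)) \<le> CARD('a)"
    using card_roots_power_minus_self[of "insert x (range to_ac)" "CARD('a)"]
      assms frob_to_ac card_field_ge_2[where 'a='a]
    by (auto simp: frob_def)
  ultimately show False by simp
qed

text \<open>The subfield $F_{q^3}$ of the algebraic closure.\<close>

definition cubic_subfield :: "'a::{field, finite} alg_closure set"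
  where "cubic_subfield = {x. frob (frob (frob x)) = x}"

lemma card_cubic_subfield:
  "finite (cubic_subfield :: 'a::{field, finite} alg_closure set)"
  "card (cubic_subfield :: 'a::{field, finite} alg_closure set) \<le> CARD('a) ^ 3"
proof -
  have "x ^ (CARD('a) ^ 3) = x" if "x \<in> cubic_subfield" for x :: "'a alg_closure"
    using that by (simp add: cubic_subfield_def frob_def power3_eq_cube flip: power_mult)
  moreover have "2 \<le> CARD('a) ^ 3"
    using card_field_ge_2[where 'a='a] self_le_power[of "CARD('a)" 3] by linarith
  ultimately show "finite (cubic_subfield :: 'a alg_closure set)"
    "card (cubic_subfield :: 'a alg_closure set) \<le> CARD('a) ^ 3"
    using card_roots_power_minus_self[of "cubic_subfield :: 'a alg_closure set" "CARD('a) ^ 3"]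
    by blast+
qed

section \<open>A point of degree six\<close>

text \<open>The map $y \<mapsto> y^3 - y^2$ takes the same value at 0 and 1, so on a finite field it is not surjective.\<close>

lemma exists_rootless_cubic: "\<exists>c::'a::{field, finite}. \<forall>y. y^3 - y^2 \<noteq> c"
proof -
  have "\<not> inj (\<lambda>y::'a. y^3 - y^2)"
    using injD[of "\<lambda>y::'a. y^3 - y^2" 0 1] by auto
  then have "\<not> surj (\<lambda>y::'a. y^3 - y^2)"
    using finite_UNIV_surj_inj[of "\<lambda>y::'a. y^3 - y^2"] by auto
  then show ?thesis
    by (auto simp: surj_def) metis
qed

text \<open>Without a root in $F_q$ the cubic $y^3 - y^2 - c$ is irreducible over $F_q$, and \<open>\<alpha>\<close> generates
$F_{q^3}$.\<close>

locale cubic_point =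
  fixes c :: "'a::{field, finite}" and \<alpha> :: "'a alg_closure"
  assumes no_root: "y^3 - y^2 \<noteq> c"
    and root: "\<alpha>^3 - \<alpha>^2 = to_ac c"
begin

lemma not_root_if_fixed:
  assumes "frob x = x"
  shows "x^3 - x^2 \<noteq> to_ac c"
proof -
  obtain y where "x = to_ac y"
    using frob_fixed[OF assms] by blast
  then have "x^3 - x^2 = to_ac (y^3 - y^2)"
    by simp
  then show ?thesis
    using no_root[of y] by (simp only: to_ac_eq_iff not_False_eq_True)
qed

lemma root_frob: "x^3 - x^2 = to_ac c \<Longrightarrow> frob x^3 - frob x^2 = to_ac c"
  by (drule arg_cong[of _ _ frob]) simp

lemma roots: "frob \<alpha>^3 - frob \<alpha>^2 = to_ac c" "frob (frob \<alpha>)^3 - frob (frob \<alpha>)^2 = to_ac c"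
  using root root_frob by blast+

text \<open>If Frobenius merely swapped two roots, it would fix the third one, which would then be a root in
$F_q$.\<close>

lemma distinct_conjugates: "distinct [\<alpha>, frob \<alpha>, frob (frob \<alpha>)]"
proof -
  have ne: "\<alpha> \<noteq> frob \<alpha>"
    using not_root_if_fixed root by metis
  have "frob (frob \<alpha>) \<noteq> \<alpha>"
  proof
    assume *: "frob (frob \<alpha>) = \<alpha>"
    \<comment> \<open>The three roots of the cubic add up to 1.\<close>
    define t where "t = 1 - \<alpha> - frob \<alpha>"
    have "frob t = t"
      using * by (simp add: t_def)
    moreover have "t^3 - t^2 = to_ac c"
    proof -
      let ?Q = "\<alpha>^2 + \<alpha> * frob \<alpha> + frob \<alpha>^2 - \<alpha> - frob \<alpha>"
      have "(\<alpha> - frob \<alpha>) * ?Q = (\<alpha>^3 - \<alpha>^2) - (frob \<alpha>^3 - frob \<alpha>^2)"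
        by (simp add: power2_eq_square power3_eq_cube algebra_simps)
      then have "?Q = 0"
        using root roots(1) ne by simp
      moreover have "t^3 - t^2 = (\<alpha>^3 - \<alpha>^2) + (t - \<alpha>) * ?Q"
        by (simp add: t_def power2_eq_square power3_eq_cube algebra_simps)
      ultimately show ?thesis
        using root by simp
    qed
    ultimately show False
      using not_root_if_fixed by blast
  qed
  with ne show ?thesis by auto
qed

lemma frob3_root: "frob (frob (frob \<alpha>)) = \<alpha>"
proof (rule ccontr)
  let ?b = "frob (frob (frob \<alpha>))"
  assume "?b \<noteq> \<alpha>"
  then have dist: "distinct [\<alpha>, frob \<alpha>, frob (frob \<alpha>), ?b]"
    using distinct_conjugates by auto
  have "(1::'a alg_closure) = 0"
    using cubic_eq_0_if_four_roots[OF dist, of "- to_ac c" 0 "-1" 1]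
      root roots root_frob[OF roots(2)] by (auto simp: algebra_simps)
  then show False by simp
qed

text \<open>Frobenius carries a relation to the conjugates of \<open>\<alpha>\<close>, and a nonzero quadratic does not have three
roots.\<close>

lemma powers_independent:
  assumes "to_ac k0 + to_ac k1 * \<alpha> + to_ac k2 * \<alpha>^2 = 0"
  shows "k0 = 0 \<and> k1 = 0 \<and> k2 = 0"
proof -
  have fr: "to_ac k0 + to_ac k1 * frob x + to_ac k2 * frob x^2 = 0"
    if "to_ac k0 + to_ac k1 * x + to_ac k2 * x^2 = 0" for x
    using arg_cong[OF that, of frob] by simp
  show ?thesis
    using quadratic_eq_0_if_three_roots[OF distinct_conjugates assms fr[OF assms] fr[OF fr[OF assms]]]
    by simp
qed

text \<open>By independence the span of $1, \<alpha>, \<alpha>^2$ over $F_q$ has $q^3$ elements; it lies in $F_{q^3}$, which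
consists of roots of $X^{q^3} - X$ and so has no more elements than that.\<close>

lemma cubic_subfield_eq:
  assumes "x \<in> cubic_subfield"
  obtains n0 n1 n2 where "x = to_ac n0 + to_ac n1 * \<alpha> + to_ac n2 * \<alpha>^2"
proof -
  define g where "g = (\<lambda>(n0, n1, n2). to_ac n0 + to_ac n1 * \<alpha> + to_ac n2 * \<alpha>^2)"
  have "inj g"
  proof (rule injI)
    fix m n assume "g m = g n"
    obtain m0 m1 m2 n0 n1 n2 where mn: "m = (m0, m1, m2)" "n = (n0, n1, n2)"
      by (metis prod_cases3)
    have "to_ac (m0 - n0) + to_ac (m1 - n1) * \<alpha> + to_ac (m2 - n2) * \<alpha>^2 = 0"
      using \<open>g m = g n\<close> by (simp add: g_def mn algebra_simps)
    then show "m = n"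
      using powers_independent mn by fastforce
  qed
  then have "card (range g) = CARD('a) ^ 3"
    by (simp add: card_image power3_eq_cube)
  moreover have "range g \<subseteq> cubic_subfield"
    by (auto simp: g_def cubic_subfield_def frob3_root)
  ultimately have "range g = cubic_subfield"
    using card_cubic_subfield[where 'a='a] by (intro card_seteq) auto
  with assms obtain n where "x = g n"
    by blast
  with that show thesis
    by (cases n) (simp add: g_def)
qed

text \<open>The map $z \<mapsto> z^2 - \<alpha>^2 z$ takes the same value at 0 and at $\<alpha>^2$, so on the finite field $F_{q^3}$
it is not surjective. The middle coefficient $\<alpha>^2$ is chosen because it lies outside the span of
1 and \<open>\<alpha>\<close>; this is what keeps the point off the conics over $F_q$.\<close>

lemma exists_rootless_quadratic:
  "\<exists>n0 n1 n2. \<forall>z\<in>cubic_subfield. z^2 - \<alpha>^2 * z \<noteq> to_ac n0 + to_ac n1 * \<alpha> + to_ac n2 * \<alpha>^2"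
proof -
  let ?h = "\<lambda>z. z^2 - \<alpha>^2 * z"
  let ?E = "cubic_subfield :: 'a alg_closure set"
  have "\<alpha> \<noteq> 0"
    using root no_root[of 0] by (auto simp: eq_commute[of 0])
  have "0 \<in> ?E" "\<alpha>^2 \<in> ?E"
    by (auto simp: cubic_subfield_def frob3_root)
  then have "\<not> inj_on ?h ?E"
    using \<open>\<alpha> \<noteq> 0\<close> inj_onD[of ?h ?E 0 "\<alpha>^2"] by (auto simp: power2_eq_square)
  moreover have "?h ` ?E \<subseteq> ?E"
    by (auto simp: cubic_subfield_def frob3_root)
  ultimately have "?h ` ?E \<noteq> ?E"
    using eq_card_imp_inj_on[of ?E ?h] card_cubic_subfield(1)[where 'a='a] by auto
  then obtain n where n: "n \<in> ?E" "n \<notin> ?h ` ?E"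
    using \<open>?h ` ?E \<subseteq> ?E\<close> by blast
  obtain n0 n1 n2 where "n = to_ac n0 + to_ac n1 * \<alpha> + to_ac n2 * \<alpha>^2"
    using cubic_subfield_eq[OF n(1)] .
  moreover have "?h z \<noteq> n" if "z \<in> ?E" for z
    using imageI[OF that, of ?h] n(2) by metis
  ultimately have "\<forall>z\<in>?E. ?h z \<noteq> to_ac n0 + to_ac n1 * \<alpha> + to_ac n2 * \<alpha>^2"
    by simp
  then show ?thesis
    by blast
qed

end

section \<open>Lines on the cubics through the six conjugate points\<close>

text \<open>Let \<open>\<beta>\<close> be a root of $z^2 - \<alpha>^2 z - (n_0 + n_1 \<alpha> + n_2 \<alpha>^2)$, a quadratic that is irreducible over
$F_{q^3}$. The point meant here is $[1 : \<alpha> : \<beta>]$. It does not occur as a parameter, because it is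
enough to know that such a root never lies in $F_{q^3}$.\<close>

locale sextic_point = cubic_point c \<alpha>
  for c :: "'a::{field, finite}" and \<alpha> :: "'a alg_closure" +
  fixes n0 n1 n2 :: 'a
  assumes no_root_quadratic:
    "z \<in> cubic_subfield \<Longrightarrow> z^2 - \<alpha>^2 * z \<noteq> to_ac n0 + to_ac n1 * \<alpha> + to_ac n2 * \<alpha>^2"
begin

abbreviation C where "C \<equiv> to_ac c"
abbreviation N0 where "N0 \<equiv> to_ac n0"
abbreviation N1 where "N1 \<equiv> to_ac n1"
abbreviation N2 where "N2 \<equiv> to_ac n2"

text \<open>The value at $(x, y, z)$ of the general cubic form over $F_q$ that vanishes at $[1 : \<alpha> : \<beta>]$. The
forms with coefficients \<open>a1\<close>, \<open>a2\<close> and \<open>a3\<close> express $\<beta>^2$, $\<alpha> \<beta>^2$ and $\<beta>^3$ through lower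
monomials: the relation for \<open>\<beta>\<close> lowers the degree in $z$ below 2, the relation for \<open>\<alpha>\<close> lowers the
degree in $y$ as far as a total degree of 3 requires, and $x$ makes the result homogeneous. The last
form is $y^3 - x y^2 - c x^3$, the product of the three conjugates of the
line $y = \<alpha> x$.\<close>

definition cubic_value where
  "cubic_value a1 a2 a3 a4 x y z =
     to_ac a1 * (x * z^2 - y^2 * z - N0 * x^3 - N1 * x^2 * y - N2 * x * y^2) +
     to_ac a2 * (y * z^2 - (y^2 + C * x^2) * z - N0 * x^2 * y - N1 * x * y^2 - N2 * y^3) +
     to_ac a3 * (z^3 - ((1 + N2) * y^2 + (C + N1) * x * y + (C + N0) * x^2) * z
       - N0 * x * y^2 - (N1 + N2) * y^3 - N2 * C * x^2 * y) +
     to_ac a4 * (y^3 - x * y^2 - C * x^3)"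

lemma frob_cubic_value:
  "frob (cubic_value a1 a2 a3 a4 x y z) = cubic_value a1 a2 a3 a4 (frob x) (frob y) (frob z)"
  by (simp add: cubic_value_def)

text \<open>On the vertical line $y = b x$ through a conjugate $b$ of \<open>\<alpha>\<close> two of the intersection points are
prescribed, namely those with the conjugates of $[1 : \<alpha> : \<beta>]$ above $b$. They account for the
quadratic factor, and the third intersection point for the other one.\<close>

lemma cubic_value_at_root:
  assumes "b^3 - b^2 = C"
  shows "cubic_value a1 a2 a3 a4 1 b z =
    (to_ac a1 + to_ac a2 * b + to_ac a3 * (z + b^2)) * (z^2 - b^2 * z - (N0 + N1 * b + N2 * b^2))"
proof -
  have C: "C = b^3 - b^2" using assms by simp
  show ?thesis
    unfolding cubic_value_def C
    by (simp add: power2_eq_square power3_eq_cube algebra_simps)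
qed

lemma cubic_value_as_poly_in_z:
  "cubic_value a1 a2 a3 a4 1 y z =
     (- to_ac a1 * (N0 + N1 * y + N2 * y^2) - to_ac a2 * (N0 * y + N1 * y^2 + N2 * y^3)
      - to_ac a3 * (N0 * y^2 + (N1 + N2) * y^3 + N2 * C * y) + to_ac a4 * (y^3 - y^2 - C)) +
     (- to_ac a1 * y^2 - to_ac a2 * (y^2 + C)
      - to_ac a3 * ((1 + N2) * y^2 + (C + N1) * y + (C + N0))) * z +
     (to_ac a1 + to_ac a2 * y) * z^2 + to_ac a3 * z^3"
  unfolding cubic_value_def
  by (simp add: power2_eq_square power3_eq_cube algebra_simps)

text \<open>A cubic meets a vertical line in at most three points outside $[0 : 0 : 1]$ unless it contains that
line. In that case the coefficients of $z^3$ and $z^2$ give $a_3 = 0$ and $a_1 = - a_2 y$, and the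
coefficient of $z$ becomes $a_2 (y^3 - y^2 - c)$. If $a_2$ were not zero, then $y = - a_1 / a_2$ would be
a root of the cubic in $F_q$.\<close>

lemma vertical_fibre:
  assumes "distinct [z1, z2, z3, z4]"
    "\<And>z. z \<in> {z1, z2, z3, z4} \<Longrightarrow> cubic_value a1 a2 a3 a4 1 y z = 0"
  shows "a3 = 0" "a1 = 0" "a2 = 0" "a4 = 0 \<or> y^3 - y^2 = C"
proof -
  have *: "a3 = 0" "to_ac a1 + to_ac a2 * y = 0"
    "- to_ac a1 * y^2 - to_ac a2 * (y^2 + C)
      - to_ac a3 * ((1 + N2) * y^2 + (C + N1) * y + (C + N0)) = 0"
    "- to_ac a1 * (N0 + N1 * y + N2 * y^2) - to_ac a2 * (N0 * y + N1 * y^2 + N2 * y^3)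
      - to_ac a3 * (N0 * y^2 + (N1 + N2) * y^3 + N2 * C * y) + to_ac a4 * (y^3 - y^2 - C) = 0"
    using cubic_eq_0_if_four_roots[OF assms(1)] assms(2)
    unfolding cubic_value_as_poly_in_z by (metis to_ac_eq_0_iff)+
  have a1: "to_ac a1 = - to_ac a2 * y"
    using *(2) by (simp add: eq_neg_iff_add_eq_0)
  have "to_ac a2 * (y^3 - y^2 - C) = 0"
    using *(1,3) unfolding a1 by (simp add: power2_eq_square power3_eq_cube algebra_simps)
  then have "a2 = 0"
  proof (rule contrapos_pp)
    assume "a2 \<noteq> 0"
    then have "y = to_ac (- a1 / a2)"
      using a1 by (simp add: field_simps)
    then have "frob y = y"
      by (simp only: frob_to_ac)
    then show "to_ac a2 * (y^3 - y^2 - C) \<noteq> 0"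
      using not_root_if_fixed \<open>a2 \<noteq> 0\<close> by simp
  qed
  with a1 * show "a3 = 0" "a1 = 0" "a2 = 0" "a4 = 0 \<or> y^3 - y^2 = C"
    by auto
qed

text \<open>Every line that avoids $[0 : 0 : 1]$ has an equation $z = p x + q y$; the condition is imposed on the
affine part $x = 1$.\<close>

definition contains_line where
  "contains_line a1 a2 a3 a4 p q \<longleftrightarrow> (\<forall>y. cubic_value a1 a2 a3 a4 1 y (p + q * y) = 0)"

lemma contains_line_frob:
  assumes "contains_line a1 a2 a3 a4 p q"
  shows "contains_line a1 a2 a3 a4 (frob p) (frob q)"
  unfolding contains_line_def
proof
  fix y :: "'a alg_closure"
  obtain y' where y': "frob y' = y"
    using surj_frob[of y] by blast
  have "frob (cubic_value a1 a2 a3 a4 1 y' (p + q * y')) = 0"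
    using assms by (simp add: contains_line_def)
  then show "cubic_value a1 a2 a3 a4 1 y (frob p + frob q * y) = 0"
    by (simp add: frob_cubic_value y')
qed

lemma finite_lines_meet:
  fixes p q p' q' :: "'b::field"
  assumes "(p, q) \<noteq> (p', q')"
  shows "finite {y. p + q * y = p' + q' * y}"
proof -
  have "[:p - p', q - q':] \<noteq> 0"
    using assms by auto
  then have "finite {y. poly [:p - p', q - q':] y = 0}"
    by (rule poly_roots_finite)
  moreover have "{y. p + q * y = p' + q' * y} \<subseteq> {y. poly [:p - p', q - q':] y = 0}"
    by (auto simp: algebra_simps)
  ultimately show ?thesis
    by (rule rev_finite_subset)
qed

text \<open>The Frobenius images of a contained line are contained as well. A cubic has no more than three linear
factors, so among four successive images two coincide. Thus the line is defined over $F_{q^2}$ or over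
$F_{q^3}$. In place of unique factorization the proof intersects with a vertical line $x = 1, y = y_0$
general enough that distinct images of the line meet it in distinct points.\<close>

lemma contained_line_period:
  assumes line: "contains_line a1 a2 a3 a4 p q"
    and nz: "\<not> (a1 = 0 \<and> a2 = 0 \<and> a3 = 0 \<and> a4 = 0)"
  shows "frob (frob p) = p \<and> frob (frob q) = q \<or> p \<in> cubic_subfield \<and> q \<in> cubic_subfield"
proof (rule ccontr)
  assume not: "\<not> ?thesis"
  define P where "P = (\<lambda>k. (frob ^^ k) p)"
  define Q where "Q = (\<lambda>k. (frob ^^ k) q)"
  have PQ: "P 0 = p" "P 1 = frob p" "P 2 = frob (frob p)" "P 3 = frob (frob (frob p))"
    "Q 0 = q" "Q 1 = frob q" "Q 2 = frob (frob q)" "Q 3 = frob (frob (frob q))"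
    by (simp_all add: P_def Q_def numeral_2_eq_2 numeral_3_eq_3)
  have dist: "(P i, Q i) \<noteq> (P j, Q j)" if "i < j" "j \<le> 3" for i j
  proof -
    from that consider "i = 0 \<and> j = 1" | "i = 0 \<and> j = 2" | "i = 0 \<and> j = 3" | "i = 1 \<and> j = 2"
      | "i = 1 \<and> j = 3" | "i = 2 \<and> j = 3"
      by linarith
    then show ?thesis
      using not by cases (auto simp: PQ cubic_subfield_def simp del: One_nat_def)
  qed
  let ?B = "{y. y^3 - y^2 = C} \<union>
    (\<Union>j\<in>{..3}. \<Union>i\<in>{..<j}. {y. P i + Q i * y = P j + Q j * y})"
  have "finite {y. y^3 - y^2 = C}"
  proof (rule finite_subset)
    show "{y. y^3 - y^2 = C} \<subseteq> {y. poly [:- C, 0, - 1, 1:] y = 0}"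
      by (auto simp: power2_eq_square power3_eq_cube algebra_simps)
    show "finite {y. poly [:- C, 0, - 1, 1:] y = 0}"
      by (rule poly_roots_finite) simp
  qed
  moreover have "finite {y. P i + Q i * y = P j + Q j * y}" if "i < j" "j \<le> 3" for i j
    using dist[OF that] by (rule finite_lines_meet)
  ultimately have "finite ?B"
    by auto
  then obtain y where y: "y \<notin> ?B"
    using ex_new_if_finite[OF infinite_alg_closed_field] by blast
  have ne: "P i + Q i * y \<noteq> P j + Q j * y" if "i < j" "j \<le> 3" for i j
    using y that by auto
  have dist4: "distinct [P 0 + Q 0 * y, P 1 + Q 1 * y, P 2 + Q 2 * y, P 3 + Q 3 * y]"
    using ne[of 0 1] ne[of 0 2] ne[of 0 3] ne[of 1 2] ne[of 1 3] ne[of 2 3] by simp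
  have "contains_line a1 a2 a3 a4 (P k) (Q k)" for k
    by (induction k) (use line contains_line_frob in \<open>auto simp: P_def Q_def\<close>)
  then have zero: "cubic_value a1 a2 a3 a4 1 y z = 0"
    if "z \<in> {P 0 + Q 0 * y, P 1 + Q 1 * y, P 2 + Q 2 * y, P 3 + Q 3 * y}" for z
    using that by (auto simp: contains_line_def)
  have "y^3 - y^2 \<noteq> C"
    using y by simp
  then show False
    using nz vertical_fibre[OF dist4 zero] by simp
qed

text \<open>Suppose that the line passes through $[1 : \<alpha> : \<beta>]$, so that $\<beta> = p + q \<alpha>$. If the line is defined
over $F_{q^3}$, then \<open>\<beta>\<close> lies in $F_{q^3}$, which is excluded. If it is defined over $F_{q^2}$, then
together with its conjugate it forms a conic over $F_q$ through the point. Comparing its equation with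
the quadratic equation for \<open>\<beta>\<close> gives $D \<beta> = R$ with $D, R \<in> F_{q^3}$. Here $D \<noteq> 0$, since $\<alpha>^2$ is
not in the span of 1 and \<open>\<alpha>\<close>, and again \<open>\<beta>\<close> lies in $F_{q^3}$.\<close>

lemma contained_line_avoids_point:
  assumes line: "contains_line a1 a2 a3 a4 p q"
    and nz: "\<not> (a1 = 0 \<and> a2 = 0 \<and> a3 = 0 \<and> a4 = 0)"
  shows "(p + q * \<alpha>)^2 - \<alpha>^2 * (p + q * \<alpha>) \<noteq> N0 + N1 * \<alpha> + N2 * \<alpha>^2"
proof
  let ?z = "p + q * \<alpha>"
  assume z: "?z^2 - \<alpha>^2 * ?z = N0 + N1 * \<alpha> + N2 * \<alpha>^2"
  from contained_line_period[OF line nz] have "?z \<in> cubic_subfield"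
  proof
    assume "p \<in> cubic_subfield \<and> q \<in> cubic_subfield"
    then show ?thesis
      by (simp add: cubic_subfield_def frob3_root)
  next
    assume per: "frob (frob p) = p \<and> frob (frob q) = q"
    define D where "D = \<alpha>^2 - (p + frob p) - (q + frob q) * \<alpha>"
    define R where "R = - p * frob p - (p * frob q + frob p * q) * \<alpha> - q * frob q * \<alpha>^2
      - (N0 + N1 * \<alpha> + N2 * \<alpha>^2)"
    have "D * ?z = R"
      unfolding z[symmetric] D_def R_def by (simp add: power2_eq_square algebra_simps)
    have "p + frob p \<in> range to_ac" "q + frob q \<in> range to_ac"
      using per by (auto intro!: frob_fixed)
    then obtain t u where "p + frob p = to_ac t" "q + frob q = to_ac u"
      by blast
    then have "D = to_ac (- t) + to_ac (- u) * \<alpha> + to_ac 1 * \<alpha>^2"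
      by (simp add: D_def)
    then have "D \<noteq> 0"
      using powers_independent by fastforce
    have DR: "frob (frob (frob D)) = D" "frob (frob (frob R)) = R"
      unfolding D_def R_def using per by (simp_all add: frob3_root algebra_simps)
    have "D * frob (frob (frob ?z)) = frob (frob (frob (D * ?z)))"
      by (simp add: DR)
    also have "\<dots> = D * ?z"
      by (simp only: \<open>D * ?z = R\<close> DR)
    finally show ?thesis
      using \<open>D \<noteq> 0\<close> by (simp add: cubic_subfield_def)
  qed
  then show False
    using no_root_quadratic z by blast
qed

text \<open>By \<open>contained_line_avoids_point\<close>, applied to the line and to its Frobenius images, the line passes
through none of the six points. So over each of the three conjugates of \<open>\<alpha>\<close> it passes through the third
intersection point of the cubic, which means that a quadratic polynomial has three roots.\<close>

lemma contains_no_nonvertical_line: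
  assumes line: "contains_line a1 a2 a3 a4 p q"
  shows "a1 = 0 \<and> a2 = 0 \<and> a3 = 0 \<and> a4 = 0"
proof (rule ccontr)
  assume nz: "\<not> ?thesis"
  have lines: "contains_line a1 a2 a3 a4 (frob p) (frob q)"
    "contains_line a1 a2 a3 a4 (frob (frob p)) (frob (frob q))"
    using contains_line_frob[OF line] contains_line_frob[OF contains_line_frob[OF line]] by this+
  have step: "to_ac a1 + to_ac a2 * b + to_ac a3 * ((p + q * b) + b^2) = 0"
    if b: "b^3 - b^2 = C" and avoid: "(p + q * b)^2 - b^2 * (p + q * b) \<noteq> N0 + N1 * b + N2 * b^2" for b
  proof -
    have "cubic_value a1 a2 a3 a4 1 b (p + q * b) = 0"
      using line by (simp only: contains_line_def)
    then show ?thesis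
      using avoid unfolding cubic_value_at_root[OF b] mult_eq_0_iff right_minus_eq by blast
  qed
  have 0: "to_ac a1 + to_ac a2 * \<alpha> + to_ac a3 * ((p + q * \<alpha>) + \<alpha>^2) = 0"
    using step[OF root] contained_line_avoids_point[OF line nz] by blast
  have 1: "to_ac a1 + to_ac a2 * frob \<alpha> + to_ac a3 * ((p + q * frob \<alpha>) + frob \<alpha>^2) = 0"
  proof (rule step[OF roots(1)], rule notI)
    let ?z = "p + q * frob \<alpha>"
    assume "?z^2 - frob \<alpha>^2 * ?z = N0 + N1 * frob \<alpha> + N2 * frob \<alpha>^2"
    from arg_cong[OF arg_cong[OF this, of frob], of frob] show False
      using contained_line_avoids_point[OF lines(2) nz] by (simp add: frob3_root)
  qed
  have 2: "to_ac a1 + to_ac a2 * frob (frob \<alpha>) + to_ac a3 * ((p + q * frob (frob \<alpha>)) + frob (frob \<alpha>)^2) = 0"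
  proof (rule step[OF roots(2)], rule notI)
    let ?z = "p + q * frob (frob \<alpha>)"
    assume "?z^2 - frob (frob \<alpha>)^2 * ?z = N0 + N1 * frob (frob \<alpha>) + N2 * frob (frob \<alpha>)^2"
    from arg_cong[OF this, of frob] show False
      using contained_line_avoids_point[OF lines(1) nz] by (simp add: frob3_root)
  qed
  have "to_ac a1 + to_ac a3 * p = 0 \<and> to_ac a2 + to_ac a3 * q = 0 \<and> to_ac a3 = 0"
    by (rule quadratic_eq_0_if_three_roots[OF distinct_conjugates])
       (use 0 1 2 in \<open>simp_all add: algebra_simps\<close>)
  then have a: "a1 = 0" "a2 = 0" "a3 = 0"
    by auto
  have "cubic_value a1 a2 a3 a4 1 0 p = 0"
    using line by (auto simp: contains_line_def dest: spec[of _ 0])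
  then have "a4 = 0"
    using a no_root[of 0] by (auto simp: cubic_value_def)
  with a nz show False by simp
qed

text \<open>A line through $[0 : 0 : 1]$ is $x = 0$ or $y = \<gamma> x$. In either case the restriction of the cubic to the
line is a polynomial in $z$ that vanishes identically.\<close>

lemma contained_line:
  assumes uvw: "\<not> (u = 0 \<and> v = 0 \<and> w = 0)"
    and line: "\<And>x y z. u * x + v * y + w * z = 0 \<Longrightarrow> cubic_value a1 a2 a3 a4 x y z = 0"
  shows "a1 = 0 \<and> a2 = 0 \<and> a3 = 0"
proof (cases "w = 0")
  case False
  have "contains_line a1 a2 a3 a4 (- u / w) (- v / w)"
    unfolding contains_line_def
    by (intro allI line) (use False in \<open>simp add: field_simps\<close>)
  then show ?thesis
    using contains_no_nonvertical_line by blast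
next
  case w: True
  obtain S :: "'a alg_closure set" where "card S = 4" "finite S"
    using infinite_arbitrarily_large[OF infinite_alg_closed_field] by blast
  then obtain t1 t2 t3 t4 where t: "distinct [t1, t2, t3, t4 :: 'a alg_closure]"
    by (auto simp: numeral_eq_Suc card_Suc_eq)
  show ?thesis
  proof (cases "v = 0")
    case False
    have "cubic_value a1 a2 a3 a4 1 (- u / v) z = 0" for z
      by (rule line) (use False w in simp)
    from vertical_fibre[OF t this] show ?thesis
      by simp
  next
    case True
    have v: "cubic_value a1 a2 a3 a4 0 1 z = 0" for z
      by (rule line) (use True w in simp)
    have "(to_ac a4 - to_ac a2 * N2 - to_ac a3 * (N1 + N2)) + (- to_ac a1 - to_ac a2 - to_ac a3 * (1 + N2)) * z
        + to_ac a2 * z^2 + to_ac a3 * z^3 = 0" for z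
      using v[of z] by (simp add: cubic_value_def algebra_simps)
    from cubic_eq_0_if_four_roots[OF t this] show ?thesis
      by auto
  qed
qed

end

section \<open>The linear system\<close>

definition monomial :: "'a::zero \<Rightarrow> nat \<Rightarrow> nat \<Rightarrow> nat \<Rightarrow> 'a ternary_poly"
  where "monomial k i j l = Poly_Mapping.single
    (Poly_Mapping.single 1 i + Poly_Mapping.single 2 j + Poly_Mapping.single 3 l) k"

lemma (in coeff_hom) eval_monomial [simp]: "eval_at \<phi> x y z (monomial k i j l) = \<phi> k * (x ^ i * y ^ j * z ^ l)"
  by (simp add: monomial_def lookup_add lookup_single)

lemma homogeneous_monomial [simp]: "i + j + l = d \<Longrightarrow> homogeneous d (monomial k i j l)"
  by (auto simp: homogeneous_def monomial_def sum_3 lookup_add lookup_single split: if_splits)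

lemma homogeneous_add: "homogeneous d F \<Longrightarrow> homogeneous d G \<Longrightarrow> homogeneous d (F + G)"
  using keys_add[of F G] by (auto simp: homogeneous_def)

lemma homogeneous_const_poly_mult:
  fixes F :: "'a::field ternary_poly"
  assumes "homogeneous d F"
  shows "homogeneous d (const_poly k * F)"
  unfolding homogeneous_def
proof
  fix m assume "m \<in> Poly_Mapping.keys (const_poly k * F)"
  also have "\<dots> \<subseteq> Poly_Mapping.keys F"
    using keys_mult[of "const_poly k" F] by (auto simp: const_poly_def split: if_splits)
  finally show "(\<Sum>i\<in>UNIV. Poly_Mapping.lookup m i) = d"
    using assms by (simp add: homogeneous_def)
qed

lemma homogeneous_map: "homogeneous d F \<Longrightarrow> f 0 = 0 \<Longrightarrow> homogeneous d (Poly_Mapping.map f F)"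
  by (auto simp: homogeneous_def in_keys_iff lookup_map_0)

lemma homogeneous_member:
  assumes "\<And>i. homogeneous d (F i)"
  shows "homogeneous d (member F a)"
  unfolding member_def sum_4
  by (intro homogeneous_add homogeneous_const_poly_mult assms)

lemma coeff_hom_to_ac: "coeff_hom (to_ac :: 'a::field \<Rightarrow> _)"
  by unfold_locales auto

text \<open>The generators whose combination with coefficients \<open>a1\<close>, \<open>a2\<close>, \<open>a3\<close>, \<open>a4\<close> takes the values
\<open>cubic_value a1 a2 a3 a4\<close>.\<close>

definition cubic_system :: "'a::field \<Rightarrow> 'a \<Rightarrow> 'a \<Rightarrow> 'a \<Rightarrow> 4 \<Rightarrow> 'a ternary_poly"
  where "cubic_system c n0 n1 n2 i =
    (if i = 1 then monomial 1 1 0 2 + monomial (- 1) 0 2 1 + monomial (- n0) 3 0 0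
       + monomial (- n1) 2 1 0 + monomial (- n2) 1 2 0
     else if i = 2 then monomial 1 0 1 2 + monomial (- 1) 0 2 1 + monomial (- c) 2 0 1
       + monomial (- n0) 2 1 0 + monomial (- n1) 1 2 0 + monomial (- n2) 0 3 0
     else if i = 3 then monomial 1 0 0 3 + monomial (- (1 + n2)) 0 2 1 + monomial (- (c + n1)) 1 1 1
       + monomial (- (c + n0)) 2 0 1 + monomial (- n0) 1 2 0 + monomial (- (n1 + n2)) 0 3 0
       + monomial (- (n2 * c)) 2 1 0
     else monomial 1 0 3 0 + monomial (- 1) 1 2 0 + monomial (- c) 3 0 0)"

lemma homogeneous_cubic_system: "homogeneous 3 (cubic_system c n0 n1 n2 i)"
  unfolding cubic_system_def by (simp add: homogeneous_add)

context sextic_point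
begin

abbreviation system :: "4 \<Rightarrow> 'a ternary_poly"
  where "system \<equiv> cubic_system c n0 n1 n2"

lemma eval_member:
  "eval_at to_ac x y z (member system a) = cubic_value (a $ 1) (a $ 2) (a $ 3) (a $ 4) x y z"
proof -
  interpret coeff_hom "to_ac :: 'a \<Rightarrow> _"
    by (rule coeff_hom_to_ac)
  show ?thesis
    unfolding member_def sum_4
    by (simp add: cubic_system_def cubic_value_def) (simp add: algebra_simps power2_eq_square power3_eq_cube)
qed

lemma vec_4_eq_0_iff: "a = 0 \<longleftrightarrow> a $ 1 = 0 \<and> a $ 2 = 0 \<and> a $ 3 = 0 \<and> a $ 4 = 0"
  for a :: "'b::zero ^ 4"
  by (simp add: vec_eq_iff forall_4)

lemma member_nonzero:
  assumes "a \<noteq> 0"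
  shows "member system a \<noteq> 0"
proof
  assume "member system a = 0"
  then have "cubic_value (a $ 1) (a $ 2) (a $ 3) (a $ 4) x y z = 0" for x y z
    using eval_member[of x y z a] by (simp add: coeff_hom.eval_0[OF coeff_hom_to_ac])
  then have "contains_line (a $ 1) (a $ 2) (a $ 3) (a $ 4) 0 0"
    by (simp add: contains_line_def)
  then show False
    using contains_no_nonvertical_line assms vec_4_eq_0_iff by blast
qed

lemma geometrically_reducible_member:
  fixes a :: "'a ^ 4"
  assumes "a \<noteq> 0" "\<not> geometrically_irreducible (member system a)"
  shows "a $ 1 = 0 \<and> a $ 2 = 0 \<and> a $ 3 = 0"
proof -
  let ?M = "Poly_Mapping.map to_ac (member system a)"
  have "homogeneous 3 ?M"
    by (intro homogeneous_map homogeneous_member homogeneous_cubic_system to_ac_0)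
  moreover have "?M \<noteq> 0"
    using member_nonzero[OF assms(1)] by (auto simp: poly_mapping_eq_iff fun_eq_iff lookup_map_0)
  moreover have "\<not> irreducible_poly ?M"
    using assms(2) by (simp add: geometrically_irreducible_def)
  ultimately obtain u v w where uvw: "\<not> (u = 0 \<and> v = 0 \<and> w = 0)"
    and line: "\<forall>x y z. u * x + v * y + w * z = 0 \<longrightarrow> eval_at (\<lambda>k. k) x y z ?M = 0"
    using reducible_cubic_contains_line[OF coeff_hom_id] by blast
  show ?thesis
    by (rule contained_line[OF uvw, where ?a4.0 = "a $ 4"])
       (use line in \<open>simp add: eval_map[OF coeff_hom_to_ac] eval_member\<close>)
qed

text \<open>A linear factor over $F_q$ leaves only the multiples of $y^3 - x y^2 - c x^3$, and that product of three
conjugate lines contains no line over $F_q$ because $y^3 - y^2 - c$ has no root there.\<close>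

lemma irreducible_member:
  fixes a :: "'a ^ 4"
  assumes "a \<noteq> 0"
  shows "irreducible_poly (member system a)"
proof (rule ccontr)
  assume red: "\<not> irreducible_poly (member system a)"
  have "homogeneous 3 (member system a)"
    by (intro homogeneous_member homogeneous_cubic_system)
  then obtain u v w where uvw: "\<not> (u = 0 \<and> v = 0 \<and> w = 0)"
    and line: "\<forall>x y z. to_ac u * x + to_ac v * y + to_ac w * z = 0 \<longrightarrow>
      eval_at to_ac x y z (member system a) = 0"
    using reducible_cubic_contains_line[OF coeff_hom_to_ac _ member_nonzero[OF assms] red] by blast
  have van: "cubic_value (a $ 1) (a $ 2) (a $ 3) (a $ 4) x y z = 0"
    if "to_ac u * x + to_ac v * y + to_ac w * z = 0" for x y z
    using line that by (simp add: eval_member)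
  have "\<not> (to_ac u = 0 \<and> to_ac v = 0 \<and> to_ac w = 0)"
    using uvw by simp
  from contained_line[OF this van] have a123: "a $ 1 = 0" "a $ 2 = 0" "a $ 3 = 0"
    by simp_all
  then have a4: "a $ 4 \<noteq> 0"
    using assms vec_4_eq_0_iff by blast
  consider "w \<noteq> 0" | "w = 0" "v \<noteq> 0" | "w = 0" "v = 0"
    by blast
  then show False
  proof cases
    case 1
    have "contains_line (a $ 1) (a $ 2) (a $ 3) (a $ 4) (- to_ac u / to_ac w) (- to_ac v / to_ac w)"
      unfolding contains_line_def
      by (intro allI van) (use 1 in \<open>simp add: field_simps\<close>)
    then show False
      using contains_no_nonvertical_line a4 by blast
  next
    case 2
    let ?y = "- u / v"
    have "cubic_value (a $ 1) (a $ 2) (a $ 3) (a $ 4) 1 (to_ac ?y) 0 = 0"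
      by (rule van) (use 2 in simp)
    then have "to_ac (a $ 4) * (to_ac ?y^3 - to_ac ?y^2 - C) = 0"
      by (simp only: cubic_value_def a123) simp
    then have "to_ac ?y^3 - to_ac ?y^2 = C"
      using a4 by simp
    with not_root_if_fixed[OF frob_to_ac, of ?y] show False
      by blast
  next
    case 3
    have "cubic_value (a $ 1) (a $ 2) (a $ 3) (a $ 4) 0 1 0 = 0"
      by (rule van) (use 3 in simp)
    with a4 show False
      by (simp add: cubic_value_def a123)
  qed
qed

lemma linearly_independent_system: "linearly_independent system"
  using member_nonzero by (auto simp: linearly_independent_def)

lemma geometrically_reducible_unique:
  fixes a b :: "'a ^ 4"
  assumes a: "a \<noteq> 0" "\<not> geometrically_irreducible (member system a)"
    and b: "b \<noteq> 0" "\<not> geometrically_irreducible (member system b)"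
  shows "same_point a b"
proof -
  have "a $ 1 = 0 \<and> a $ 2 = 0 \<and> a $ 3 = 0" "b $ 1 = 0 \<and> b $ 2 = 0 \<and> b $ 3 = 0"
    using geometrically_reducible_member a b by blast+
  moreover from this have "a $ 4 \<noteq> 0" "b $ 4 \<noteq> 0"
    using a(1) b(1) vec_4_eq_0_iff by blast+
  ultimately show ?thesis
    unfolding same_point_def
    by (intro exI[of _ "b $ 4 / a $ 4"]) (simp add: vec_eq_iff forall_4)
qed

end

lemma exists_sextic_point:
  "\<exists>(c :: 'a::{field, finite}) \<alpha> n0 n1 n2. sextic_point c \<alpha> n0 n1 n2"
proof -
  obtain c :: 'a where c: "\<And>y. y^3 - y^2 \<noteq> c"
    using exists_rootless_cubic by blast
  obtain \<alpha> where "poly [:- to_ac c, 0, - 1, 1:] \<alpha> = 0"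
    using alg_closed_imp_poly_has_root[of "[:- to_ac c, 0, - 1, 1:]"] by auto
  then have "\<alpha>^3 - \<alpha>^2 = to_ac c"
    by (simp add: power2_eq_square power3_eq_cube algebra_simps)
  with c interpret cubic_point c \<alpha>
    by unfold_locales
  obtain n0 n1 n2 where
    "\<forall>z\<in>cubic_subfield. z^2 - \<alpha>^2 * z \<noteq> to_ac n0 + to_ac n1 * \<alpha> + to_ac n2 * \<alpha>^2"
    using exists_rootless_quadratic by blast
  then have "sextic_point c \<alpha> n0 n1 n2"
    by unfold_locales blast
  then show ?thesis by blast
qed

theorem theorem5:
  shows "\<exists>F :: 4 \<Rightarrow> 'a::{field, finite} ternary_poly.
    (\<forall>i. homogeneous 3 (F i)) \<and>
    linearly_independent F \<and>
    (\<forall>a. a \<noteq> 0 \<longrightarrow> irreducible_poly (member F a)) \<and>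
    (\<forall>a b. a \<noteq> 0 \<and> b \<noteq> 0 \<and>
       \<not> geometrically_irreducible (member F a) \<and>
       \<not> geometrically_irreducible (member F b) \<longrightarrow> same_point a b)"
proof -
  obtain c :: 'a and \<alpha> n0 n1 n2 where "sextic_point c \<alpha> n0 n1 n2"
    using exists_sextic_point by blast
  then interpret sextic_point c \<alpha> n0 n1 n2 .
  show ?thesis
    by (intro exI[of _ system] conjI allI impI)
       (auto intro: homogeneous_cubic_system linearly_independent_system irreducible_member
          geometrically_reducible_unique)
qed

end
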